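(* Let $(J_2,\circ)$ be the Jordan algebra over $\mathbb{C}$ with basis $\{e_1,e_2\}$ and $e_1\circ e_1=2e_1$, $e_1\circ e_2=e_2\circ e_1=2e_2$, $e_2\circ e_2=0$. Any Rota-Baxter operator on $(J_2,\circ)$ is of the form $\begin{pmatrix} 0&0\\ r_{21}&0\end{pmatrix}$ with $r_{21}\in\mathbb{C}$. The induced pre-Jordan algebra is isomorphic to $J_{6,1}$ when $r_{21}=0$, and to $J_{5,1}$ otherwise.
   Context: A Rota-Baxter operator (of weight $0$) on a Jordan algebra $(J,\circ)$ is a linear map $R:J\to J$ with $R(x)\circ R(y)=R(R(x)\circ y+x\circ R(y))$ for all $x,y\in J$. The matrix $(r_{ij})$ of $R$ in a basis $\{e_i\}$ is defined by $R(e_i)=\sum_j r_{ji}e_j$. The pre-Jordan algebra induced by $R$ is $J$ with the multiplication $x\cdot y:=R(x)\circ y$. Isomorphisms are bijective linear maps preserving the multiplication $\cdot$. $J_{5,1}$ is the algebra with basis $\{e_1,e_2\}$, $e_1\cdot e_1=e_2$ and all other products of basis elements zero; $J_{6,1}$ is the $2$-dimensional algebra with zero multiplication. *)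

theory Defs
  imports "HOL-Analysis.Analysis"
begin

locale jordan_algebra = vector_space scale
  for scale :: "'k::field \<Rightarrow> 'a::ab_group_add \<Rightarrow> 'a" +
  fixes mul :: "'a \<Rightarrow> 'a \<Rightarrow> 'a"
  assumes linear_mult_left: "Vector_Spaces.linear scale scale (\<lambda>x. mul x y)"
    and linear_mult_right: "Vector_Spaces.linear scale scale (\<lambda>y. mul x y)"
    and mult_commute: "mul x y = mul y x"
    and jordan_identity: "mul (mul x x) (mul y x) = mul (mul (mul x x) y) x"

text \<open>Rota-Baxter operators of weight 0.\<close>

locale rota_baxter_operator =
  jordan_algebra scale mul + Vector_Spaces.linear scale scale R
  for scale :: "'k::field \<Rightarrow> 'a::ab_group_add \<Rightarrow> 'a"
    and mul :: "'a \<Rightarrow> 'a \<Rightarrow> 'a"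
    and R :: "'a \<Rightarrow> 'a" +
  assumes rota_baxter: "mul (R x) (R y) = R (mul (R x) y + mul x (R y))"

definition induced_mult :: "('a \<Rightarrow> 'a \<Rightarrow> 'a) \<Rightarrow> ('a \<Rightarrow> 'a) \<Rightarrow> 'a \<Rightarrow> 'a \<Rightarrow> 'a" where
  "induced_mult mul R x y = mul (R x) y"

definition algebra_isomorphic ::
  "('k::field \<Rightarrow> 'a::ab_group_add \<Rightarrow> 'a) \<Rightarrow> ('a \<Rightarrow> 'a \<Rightarrow> 'a) \<Rightarrow>
   ('k \<Rightarrow> 'b::ab_group_add \<Rightarrow> 'b) \<Rightarrow> ('b \<Rightarrow> 'b \<Rightarrow> 'b) \<Rightarrow> bool" where
  "algebra_isomorphic scaleA multA scaleB multB \<longleftrightarrow>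
     (\<exists>\<phi>. Vector_Spaces.linear scaleA scaleB \<phi> \<and> bij \<phi> \<and>
          (\<forall>x y. \<phi> (multA x y) = multB (\<phi> x) (\<phi> y)))"

text \<open>The bilinear multiplication on coordinate space whose value on the standard basis vectors
  \<open>e\<^sub>i = axis i 1\<close> and \<open>e\<^sub>j = axis j 1\<close> is \<open>c i j\<close>.\<close>

definition mult_of_table ::
  "('n \<Rightarrow> 'n \<Rightarrow> 'k^'n) \<Rightarrow> 'k^'n \<Rightarrow> 'k^'n \<Rightarrow> ('k::field)^('n::finite)" where
  "mult_of_table c x y = (\<Sum>i\<in>UNIV. \<Sum>j\<in>UNIV. (x $ i * y $ j) *s c i j)"

definition J2 :: "complex^2 \<Rightarrow> complex^2 \<Rightarrow> complex^2" where
  "J2 = mult_of_table (\<lambda>i j.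
     if i = 1 \<and> j = 1 then 2 *s axis 1 1
     else if i = 2 \<and> j = 2 then 0
     else 2 *s axis 2 1)"

definition J5_1 :: "complex^2 \<Rightarrow> complex^2 \<Rightarrow> complex^2" where
  "J5_1 = mult_of_table (\<lambda>i j. if i = 1 \<and> j = 1 then axis 2 1 else 0)"

definition J6_1 :: "complex^2 \<Rightarrow> complex^2 \<Rightarrow> complex^2" where
  "J6_1 = mult_of_table (\<lambda>i j. 0)"

lemma mult_of_table_axis:
  fixes c :: "'n::finite \<Rightarrow> 'n \<Rightarrow> ('k::field)^'n"
  shows "mult_of_table c (axis i 1) (axis j 1) = c i j"
proof -
  have "mult_of_table c (axis i 1) (axis j 1) =
      (\<Sum>k\<in>UNIV. \<Sum>l\<in>UNIV. if l = j then if k = i then c k l else 0 else 0)"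
    unfolding mult_of_table_def by (intro sum.cong refl) (auto simp: axis_def)
  also have "\<dots> = c i j"
    by simp
  finally show ?thesis .
qed

lemma J2_components:
  "J2 x y $ 1 = 2 * (x $ 1 * y $ 1)"
  "J2 x y $ 2 = 2 * (x $ 1 * y $ 2 + x $ 2 * y $ 1)"
  by (simp_all add: J2_def mult_of_table_def sum_2 axis_def algebra_simps)

lemma jordan_algebra_J2: "jordan_algebra (*s) J2"
proof (intro jordan_algebra.intro jordan_algebra_axioms.intro)
  show "vector_space ((*s) :: complex \<Rightarrow> complex^2 \<Rightarrow> complex^2)"
    by (rule vec.vector_space_axioms)
  show "Vector_Spaces.linear (*s) (*s) (\<lambda>x. J2 x y)" for y
    by unfold_locales (simp_all add: vec_eq_iff forall_2 J2_components algebra_simps)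
  show "Vector_Spaces.linear (*s) (*s) (\<lambda>y. J2 x y)" for x
    by unfold_locales (simp_all add: vec_eq_iff forall_2 J2_components algebra_simps)
qed (simp_all add: vec_eq_iff forall_2 J2_components algebra_simps)

end

theory Submission imports Defs begin

text \<open>
  Up to a factor 2 the algebra is the ring of dual numbers: \<open>e\<^sub>1\<close> is the unit, \<open>e\<^sub>2\<close> is the nilpotent
  \<open>t\<close> with \<open>t\<^sup>2 = 0\<close>, and \<open>x \<circ> y = 2 x y\<close>.  The Rota-Baxter identity is homogeneous, so the factor
  cancels and it reads \<open>R x R y = R (R x y + x R y)\<close>.  Write \<open>R 1 = a + b t\<close> and \<open>R t = c + d t\<close>.

  \<^item> \<open>x = y = t\<close> gives \<open>(R t)\<^sup>2 = 2 R (t R t) = 2 c R t\<close>, whose unit part is \<open>c\<^sup>2 = 2 c\<^sup>2\<close>, so \<open>c = 0\<close>.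
  \<^item> With \<open>c = 0\<close>, the case \<open>x = 1\<close>, \<open>y = t\<close> gives \<open>a d t = (a + d) d t\<close>, so \<open>d = 0\<close>.
  \<^item> With \<open>c = d = 0\<close>, the case \<open>x = y = 1\<close> gives \<open>(R 1)\<^sup>2 = 2 R (R 1) = 2 a R 1\<close>, whose unit part is
    \<open>a\<^sup>2 = 2 a\<^sup>2\<close>, so \<open>a = 0\<close>.

  Hence \<open>R x = b x\<^sub>1 t\<close>.  Conversely such an \<open>R\<close> has image in \<open>\<complex> t\<close> and kills \<open>\<complex> t\<close>; as \<open>\<complex> t\<close> is an ideal
  of square zero, both sides of the identity vanish.  The induced product is
  \<open>x \<cdot> y = 2 b x\<^sub>1 y\<^sub>1 t\<close>: it is zero for \<open>b = 0\<close>, and otherwise rescaling the second coordinate by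
  \<open>1 / (2 b)\<close> turns the structure constant \<open>2 b\<close> into 1.
\<close>

lemma linear_components_2:
  fixes f :: "'k::field^2 \<Rightarrow> 'k^2"
  assumes "Vector_Spaces.linear (*s) (*s) f"
  shows "f x $ i = matrix f $ i $ 1 * x $ 1 + matrix f $ i $ 2 * x $ 2"
proof -
  have "f x = matrix f *v x"
    using matrix_works[OF assms] by simp
  then show ?thesis
    by (simp add: matrix_vector_mult_def sum_2)
qed

lemma rota_baxter_operator_J2_matrix:
  assumes "rota_baxter_operator (*s) J2 R"
  shows "matrix R $ 1 $ 1 = 0" "matrix R $ 1 $ 2 = 0" "matrix R $ 2 $ 2 = 0"
proof -
  interpret rota_baxter_operator "(*s)" J2 R
    by (fact assms)
  have R: "R x $ i = matrix R $ i $ 1 * x $ 1 + matrix R $ i $ 2 * x $ 2" for x i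
    by (rule linear_components_2) (fact linear_axioms)
  have RB: "J2 (R x) (R y) $ i = R (J2 (R x) y + J2 x (R y)) $ i" for x y i
    by (simp add: rota_baxter)
  let ?e1 = "axis 1 1 :: complex^2" and ?e2 = "axis 2 1 :: complex^2"
  show c: "matrix R $ 1 $ 2 = 0"
    using RB[of ?e2 ?e2 1] by (simp add: R J2_components axis_def algebra_simps)
  show d: "matrix R $ 2 $ 2 = 0"
    using RB[of ?e1 ?e2 2] by (simp add: R J2_components axis_def algebra_simps c)
  show "matrix R $ 1 $ 1 = 0"
    using RB[of ?e1 ?e1 1] by (simp add: R J2_components axis_def algebra_simps c d)
qed

lemma rota_baxter_operator_J2I:
  assumes lin: "Vector_Spaces.linear (*s) (*s) R"
    and M: "matrix R $ 1 $ 1 = 0" "matrix R $ 1 $ 2 = 0" "matrix R $ 2 $ 2 = 0"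
  shows "rota_baxter_operator (*s) J2 R"
proof (intro rota_baxter_operator.intro rota_baxter_operator_axioms.intro jordan_algebra_J2 lin)
  show "J2 (R x) (R y) = R (J2 (R x) y + J2 x (R y))" for x y
    by (simp add: vec_eq_iff forall_2 J2_components linear_components_2[OF lin] M)
qed

lemma induced_mult_J2_components:
  assumes "rota_baxter_operator (*s) J2 R"
  shows "induced_mult J2 R x y $ 1 = 0"
    and "induced_mult J2 R x y $ 2 = 2 * matrix R $ 2 $ 1 * (x $ 1 * y $ 1)"
proof -
  interpret rota_baxter_operator "(*s)" J2 R
    by (fact assms)
  show "induced_mult J2 R x y $ 1 = 0"
    and "induced_mult J2 R x y $ 2 = 2 * matrix R $ 2 $ 1 * (x $ 1 * y $ 1)"
    by (simp_all add: induced_mult_def J2_components linear_components_2[OF linear_axioms]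
        rota_baxter_operator_J2_matrix[OF assms])
qed

lemma J5_1_components: "J5_1 x y $ 1 = 0" "J5_1 x y $ 2 = x $ 1 * y $ 1"
  by (simp_all add: J5_1_def mult_of_table_def sum_2 axis_def)

lemma J6_1_eq_0: "J6_1 x y = 0"
  by (simp add: J6_1_def mult_of_table_def)

text \<open>
  In the basis \<open>e\<^sub>1, k e\<^sub>2\<close> the structure constant becomes 1, so the nonzero value of \<open>k\<close> does not affect
  the isomorphism class.
\<close>

lemma algebra_isomorphic_J5_1I:
  fixes mult :: "complex^2 \<Rightarrow> complex^2 \<Rightarrow> complex^2"
  assumes mult: "\<And>x y. mult x y $ 1 = 0" "\<And>x y. mult x y $ 2 = k * (x $ 1 * y $ 1)"
    and k: "k \<noteq> 0"
  shows "algebra_isomorphic (*s) mult (*s) J5_1"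
  unfolding algebra_isomorphic_def
proof (intro exI conjI allI)
  let ?\<phi> = "\<lambda>x :: complex^2. vector [x $ 1, x $ 2 / k] :: complex^2"
  let ?\<psi> = "\<lambda>x :: complex^2. vector [x $ 1, k * x $ 2] :: complex^2"
  show "Vector_Spaces.linear (*s) (*s) ?\<phi>"
    by unfold_locales (simp_all add: vec_eq_iff forall_2 algebra_simps add_divide_distrib)
  show "bij ?\<phi>"
    by (rule o_bij[where g = ?\<psi>]) (simp_all add: fun_eq_iff vec_eq_iff forall_2 k)
  show "?\<phi> (mult x y) = J5_1 (?\<phi> x) (?\<phi> y)" for x y
    by (simp add: vec_eq_iff forall_2 J5_1_components mult k)
qed

theorem proposition5p6:
  fixes R :: "complex^2 \<Rightarrow> complex^2"
  shows "(rota_baxter_operator (*s) J2 R \<longleftrightarrow>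
            Vector_Spaces.linear (*s) (*s) R \<and>
            (\<exists>r21. matrix R = vector [vector [0, 0], vector [r21, 0]]))
       \<and> (rota_baxter_operator (*s) J2 R \<longrightarrow>
            (matrix R $ 2 $ 1 = 0 \<longrightarrow>
               algebra_isomorphic (*s) (induced_mult J2 R) (*s) J6_1) \<and>
            (matrix R $ 2 $ 1 \<noteq> 0 \<longrightarrow>
               algebra_isomorphic (*s) (induced_mult J2 R) (*s) J5_1))"
proof (intro conjI iffI impI)
  assume rb: "rota_baxter_operator (*s) J2 R"
  show "Vector_Spaces.linear (*s) (*s) R"
    using rb by (rule rota_baxter_operator.axioms)
  have "matrix R = vector [vector [0, 0], vector [matrix R $ 2 $ 1, 0]]"
    by (simp add: vec_eq_iff forall_2 rota_baxter_operator_J2_matrix[OF rb])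
  then show "\<exists>r21. matrix R = vector [vector [0, 0], vector [r21, 0]]" ..
next
  assume "Vector_Spaces.linear (*s) (*s) R \<and>
    (\<exists>r21. matrix R = vector [vector [0, 0], vector [r21, 0]])"
  then show "rota_baxter_operator (*s) J2 R"
    by (auto intro: rota_baxter_operator_J2I)
next
  assume rb: "rota_baxter_operator (*s) J2 R" and "matrix R $ 2 $ 1 = 0"
  then have "induced_mult J2 R x y = J6_1 x y" for x y
    by (simp add: vec_eq_iff forall_2 induced_mult_J2_components J6_1_eq_0)
  then show "algebra_isomorphic (*s) (induced_mult J2 R) (*s) J6_1"
    unfolding algebra_isomorphic_def
    by (intro exI[of _ id]) (simp add: vec.linear_id)
next
  assume rb: "rota_baxter_operator (*s) J2 R" and "matrix R $ 2 $ 1 \<noteq> 0"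
  then show "algebra_isomorphic (*s) (induced_mult J2 R) (*s) J5_1"
    by (intro algebra_isomorphic_J5_1I[where k = "2 * matrix R $ 2 $ 1"])
      (simp_all add: induced_mult_J2_components)
qed

end
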